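(* For integers $n>2$ let $$\alpha_n^2=\min\left\{\frac{\alpha(\mathrm{Sh}_n^2[G])}{|G|} \;:\; \emptyset\neq G\subseteq V(\mathrm{Sh}_n^2)\right\}.$$ Then $$\lim_{n\to\infty}\alpha_n^2=\frac14 .$$
   Context: For an integer $n>2$, the shift graph $\mathrm{Sh}_n^2$ is the graph with vertex set $V(\mathrm{Sh}_n^2)=\{(x_1,x_2): 1\le x_1<x_2\le n\}$ (with $x_1,x_2$ integers) in which two vertices $(x_1,x_2)$ and $(y_1,y_2)$ are adjacent if $x_1=y_2$ or $y_1=x_2$. For $G\subseteq V(\mathrm{Sh}_n^2)$, $\mathrm{Sh}_n^2[G]$ denotes the subgraph of $\mathrm{Sh}_n^2$ induced by $G$, $|G|$ is the cardinality of $G$, and $\alpha(H)$ denotes the independence number (maximum size of an independent set of vertices) of a graph $H$. *)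

theory Defs
  imports Complex_Main "Graph_Theory.Pair_Digraph" "Graph_Theory.Digraph_Component"
begin

text \<open>Undirected graphs are symmetric loop-free digraphs, so every edge of the shift graph is
  represented by its two orientations.\<close>

definition shift_graph :: "nat \<Rightarrow> (nat \<times> nat, (nat \<times> nat) \<times> (nat \<times> nat)) pre_digraph" where
  "shift_graph n =
     (let V = {(x1, x2). 1 \<le> x1 \<and> x1 < x2 \<and> x2 \<le> n}
      in with_proj \<lparr> pverts = V,
                     parcs = {(x, y). x \<in> V \<and> y \<in> V \<and> (fst x = snd y \<or> fst y = snd x)} \<rparr>)"

definition independent_set :: "('a, 'b) pre_digraph \<Rightarrow> 'a set \<Rightarrow> bool" where
  "independent_set H S \<longleftrightarrow> S \<subseteq> verts H \<and> (\<forall>u\<in>S. \<forall>v\<in>S. \<not> u \<rightarrow>\<^bsub>H\<^esub> v)"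

text \<open>Meaningful for graphs with finitely many vertices.\<close>

definition independence_number :: "('a, 'b) pre_digraph \<Rightarrow> nat" where
  "independence_number H = Max {card S |S. independent_set H S}"

text \<open>The minimum is over a finite set, nonempty as soon as \<open>n \<ge> 2\<close>; for smaller \<open>n\<close> the value
  is unspecified.\<close>

definition shift_alpha :: "nat \<Rightarrow> real" where
  "shift_alpha n =
     Min {real (independence_number (shift_graph n \<restriction> G)) / real (card G) |G.
            G \<noteq> {} \<and> G \<subseteq> verts (shift_graph n)}"

lemma verts_shift_graph:
  "verts (shift_graph n) = {(x1, x2). 1 \<le> x1 \<and> x1 < x2 \<and> x2 \<le> n}"
  by (simp add: shift_graph_def Let_def)

lemma adj_shift_graph:
  "x \<rightarrow>\<^bsub>shift_graph n\<^esub> y \<longleftrightarrow>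
     x \<in> verts (shift_graph n) \<and> y \<in> verts (shift_graph n) \<and> (fst x = snd y \<or> fst y = snd x)"
  by (simp add: shift_graph_def Let_def)

lemma finite_verts_shift_graph: "finite (verts (shift_graph n))"
  by (rule finite_subset[of _ "{..n} \<times> {..n}"]) (auto simp: verts_shift_graph)

lemma graph_shift_graph: "graph (shift_graph n)"
proof -
  have "arcs (shift_graph n) \<subseteq> verts (shift_graph n) \<times> verts (shift_graph n)"
    by (auto simp: shift_graph_def Let_def)
  then have "finite (arcs (shift_graph n))"
    by (rule finite_subset) (simp add: finite_verts_shift_graph)
  then show ?thesis
    using finite_verts_shift_graph[of n]
    by unfold_locales
      (auto simp: shift_graph_def Let_def arc_to_ends_def symmetric_def sym_def)
qed

lemma adj_induced_shift_graph:
  assumes "G \<subseteq> verts (shift_graph n)"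
  shows "x \<rightarrow>\<^bsub>shift_graph n \<restriction> G\<^esub> y \<longleftrightarrow> x \<in> G \<and> y \<in> G \<and> (fst x = snd y \<or> fst y = snd x)"
  using assms by (auto simp: shift_graph_def Let_def arcs_ends_conv image_iff)

lemma independence_number_attained:
  assumes "finite (verts H)"
  shows "\<exists>S. independent_set H S \<and> card S = independence_number H"
    and "independent_set H S \<Longrightarrow> card S \<le> independence_number H"
proof -
  have "{card S |S. independent_set H S} \<subseteq> card ` Pow (verts H)"
    by (auto simp: independent_set_def)
  then have fin: "finite {card S |S. independent_set H S}"
    by (rule finite_subset) (simp add: assms)
  have "independent_set H {}"
    by (simp add: independent_set_def)
  then have "{card S |S. independent_set H S} \<noteq> {}"
    by blast
  from Max_in[OF fin this] show "\<exists>S. independent_set H S \<and> card S = independence_number H"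
    by (auto simp: independence_number_def)
  show "card S \<le> independence_number H" if "independent_set H S"
    unfolding independence_number_def using that by (intro Max_ge fin) blast
qed

lemma shift_alpha_attained:
  shows "n \<ge> 2 \<Longrightarrow> \<exists>G. G \<noteq> {} \<and> G \<subseteq> verts (shift_graph n) \<and>
      shift_alpha n = real (independence_number (shift_graph n \<restriction> G)) / real (card G)"
    and "G \<noteq> {} \<Longrightarrow> G \<subseteq> verts (shift_graph n) \<Longrightarrow>
      shift_alpha n \<le> real (independence_number (shift_graph n \<restriction> G)) / real (card G)"
proof -
  let ?f = "\<lambda>G. real (independence_number (shift_graph n \<restriction> G)) / real (card G)"
  let ?A = "{?f G |G. G \<noteq> {} \<and> G \<subseteq> verts (shift_graph n)}"
  have "?A \<subseteq> ?f ` Pow (verts (shift_graph n))"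
    by auto
  then have fin: "finite ?A"
    by (rule finite_subset) (simp add: finite_verts_shift_graph)
  show "\<exists>G. G \<noteq> {} \<and> G \<subseteq> verts (shift_graph n) \<and> shift_alpha n = ?f G" if "n \<ge> 2"
  proof -
    have "{(1, 2)} \<noteq> {} \<and> {(1, 2)} \<subseteq> verts (shift_graph n)"
      using that by (simp add: verts_shift_graph)
    then have "?A \<noteq> {}"
      by blast
    from Min_in[OF fin this] show ?thesis
      unfolding shift_alpha_def by blast
  qed
  show "shift_alpha n \<le> ?f G" if "G \<noteq> {}" "G \<subseteq> verts (shift_graph n)"
    unfolding shift_alpha_def using that by (intro Min_le fin) blast
qed

end

theory Submission
  imports Defs
begin

text \<open>An independent set of arcs of a shift graph is a directed cut: no vertex is both a tail and
  a head. A uniformly random cut contains a quarter of the arcs on average, which gives the lower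
  bound. For the upper bound take all arcs \<open>(t + 2^a, t + 2^b)\<close> with \<open>t < N\<close> and \<open>a < b < k\<close>;
  they are distinct because the powers of two form a Sidon set. If \<open>f\<close> is the indicator of the
  tails and \<open>x\<^sub>a = f (t + 2^a)\<close>, the number of cut arcs is at most the sum over \<open>t\<close> and
  \<open>a < b\<close> of \<open>x\<^sub>a (1 - x\<^sub>b) = (x\<^sub>a - x\<^sub>b) / 2 + (x\<^sub>a - x\<^sub>b)\<^sup>2 / 2\<close>. The linear part telescopes
  in \<open>t\<close> to at most \<open>2^k\<close> for each pair, and for each \<open>t\<close> the quadratic part is at most
  \<open>k\<^sup>2 / 8\<close>. So the ratio is at most \<open>k / (4 (k - 1)) + 2^k / (2 N)\<close>.\<close>

section \<open>The lower bound\<close>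

text \<open>The membership of \<open>i\<close> and \<open>j\<close> is prescribed and all other
  elements of \<open>V\<close> are free, so \<open>insert i\<close> maps the subsets of
  \<open>V - {i, j}\<close> bijectively onto the counted sets.\<close>

lemma card_Pow_separating:
  assumes "finite V" "i \<in> V" "j \<in> V" "i \<noteq> j"
  shows "4 * card {A \<in> Pow V. i \<in> A \<and> j \<notin> A} = 2 ^ card V"
proof -
  have "{A \<in> Pow V. i \<in> A \<and> j \<notin> A} = insert i ` Pow (V - {i, j})"
  proof (intro equalityI subsetI)
    fix A assume "A \<in> {A \<in> Pow V. i \<in> A \<and> j \<notin> A}"
    then have "A = insert i (A - {i})" "A - {i} \<in> Pow (V - {i, j})"
      by auto
    then show "A \<in> insert i ` Pow (V - {i, j})"
      by blast
  qed (use assms in auto)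
  moreover have "inj_on (insert i) (Pow (V - {i, j}))"
    by (rule inj_onI) blast
  ultimately have "card {A \<in> Pow V. i \<in> A \<and> j \<notin> A} = 2 ^ card (V - {i, j})"
    using assms by (simp add: card_image card_Pow)
  moreover have "card V = card (V - {i, j}) + 2"
  proof -
    have "card (V - {i, j}) = card V - card {i, j}"
      using assms by (intro card_Diff_subset) auto
    moreover have "card {i, j} \<le> card V"
      using assms by (intro card_mono) auto
    ultimately show ?thesis
      using assms by simp
  qed
  ultimately show ?thesis
    by (simp add: power_add)
qed

text \<open>The random cut is replaced by double counting over \<open>Pow V\<close>: every arc is
  cut by exactly a quarter of the subsets, so the cuts cannot all fall below the average. Loops must
  be excluded, as no subset cuts them.\<close>

lemma exists_large_cut:
  fixes G :: "('a \<times> 'a) set"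
  assumes "finite V" "G \<subseteq> V \<times> V" "\<And>i j. (i, j) \<in> G \<Longrightarrow> i \<noteq> j"
  shows "\<exists>A. card G \<le> 4 * card {e \<in> G. fst e \<in> A \<and> snd e \<notin> A}"
proof (rule ccontr)
  assume "\<not> ?thesis"
  then have less: "4 * card {e \<in> G. fst e \<in> A \<and> snd e \<notin> A} < card G" for A
    by (simp add: not_le)
  have finG: "finite G"
    using assms finite_subset by blast
  have "(\<Sum>A\<in>Pow V. 4 * card {e \<in> G. fst e \<in> A \<and> snd e \<notin> A}) < (\<Sum>A\<in>Pow V. card G)"
    by (rule sum_strict_mono) (use assms less in auto)
  also have "\<dots> = 2 ^ card V * card G"
    using assms by (simp add: card_Pow)
  also have "\<dots> = (\<Sum>e\<in>G. 4 * card {A \<in> Pow V. fst e \<in> A \<and> snd e \<notin> A})"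
  proof -
    have "4 * card {A \<in> Pow V. fst e \<in> A \<and> snd e \<notin> A} = 2 ^ card V" if "e \<in> G" for e
      using that assms(2) assms(3)[of "fst e" "snd e"]
      by (intro card_Pow_separating assms(1)) auto
    then show ?thesis
      by simp
  qed
  \<comment> \<open>Pairs of an arc and a subset cutting it are counted in both orders.\<close>
  also have "\<dots> = (\<Sum>A\<in>Pow V. 4 * card {e \<in> G. fst e \<in> A \<and> snd e \<notin> A})"
    unfolding sum_distrib_left[symmetric]
    using sum_multicount_gen[of G "Pow V" "\<lambda>e A. fst e \<in> A \<and> snd e \<notin> A"
        "\<lambda>A. card {e \<in> G. fst e \<in> A \<and> snd e \<notin> A}"] finG assms(1)
    by simp
  finally show False
    by simp
qed

lemma independent_set_induced_iff:
  assumes "G \<subseteq> verts (shift_graph n)"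
  shows "independent_set (shift_graph n \<restriction> G) S \<longleftrightarrow>
    S \<subseteq> G \<and> (\<forall>u\<in>S. \<forall>v\<in>S. fst u \<noteq> snd v)"
  unfolding independent_set_def adj_induced_shift_graph[OF assms] by auto

lemma shift_alpha_ge:
  assumes "n \<ge> 2"
  shows "1 / 4 \<le> shift_alpha n"
proof -
  obtain G where G: "G \<noteq> {}" "G \<subseteq> verts (shift_graph n)"
    and eq: "shift_alpha n = real (independence_number (shift_graph n \<restriction> G)) / real (card G)"
    using shift_alpha_attained(1)[OF assms] by blast
  have finG: "finite G"
    using G(2) finite_verts_shift_graph finite_subset by blast
  have "G \<subseteq> {..n} \<times> {..n}" "\<And>i j. (i, j) \<in> G \<Longrightarrow> i \<noteq> j"
    using G(2) by (auto simp: verts_shift_graph)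
  then obtain A where A: "card G \<le> 4 * card {e \<in> G. fst e \<in> A \<and> snd e \<notin> A}"
    using exists_large_cut[of "{..n}" G] by blast
  have "independent_set (shift_graph n \<restriction> G) {e \<in> G. fst e \<in> A \<and> snd e \<notin> A}"
    unfolding independent_set_induced_iff[OF G(2)] by auto
  then have "card {e \<in> G. fst e \<in> A \<and> snd e \<notin> A} \<le> independence_number (shift_graph n \<restriction> G)"
    by (rule independence_number_attained(2)[rotated]) (simp add: finG)
  with A have "card G \<le> 4 * independence_number (shift_graph n \<restriction> G)"
    by linarith
  then have "real (card G) \<le> 4 * real (independence_number (shift_graph n \<restriction> G))"
    by (metis of_nat_le_iff of_nat_mult of_nat_numeral)
  moreover have "card G > 0"
    using G(1) finG by (simp add: card_gt_0_iff)
  ultimately show ?thesis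
    by (simp add: eq field_simps)
qed

section \<open>The upper bound\<close>

text \<open>This is Lagrange's identity with one vector constantly 1.\<close>

lemma sum_pairs_diff_squared:
  fixes x :: "nat \<Rightarrow> real"
  shows "(\<Sum>b<k. \<Sum>a<b. (x a - x b)\<^sup>2) = real k * (\<Sum>a<k. (x a)\<^sup>2) - (\<Sum>a<k. x a)\<^sup>2"
proof (induction k)
  case (Suc k)
  have "(\<Sum>a<k. (x a - x k)\<^sup>2) = (\<Sum>a<k. (x a)\<^sup>2) - 2 * x k * (\<Sum>a<k. x a) + real k * (x k)\<^sup>2"
    by (simp add: power2_diff sum.distrib sum_subtractf sum_distrib_left mult_ac)
  with Suc show ?case
    by (simp add: power2_eq_square algebra_simps)
qed simp

text \<open>If \<open>s\<close> of the \<open>k\<close> values are 1, the sum is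
  \<open>s * (k - s)\<close>; completing the square gives the bound.\<close>

lemma sum_pairs_diff_squared_le:
  fixes x :: "nat \<Rightarrow> real"
  assumes "\<And>a. x a \<in> {0, 1}"
  shows "(\<Sum>b<k. \<Sum>a<b. (x a - x b)\<^sup>2) \<le> (real k)\<^sup>2 / 4"
proof -
  have "(x a)\<^sup>2 = x a" for a
    using assms[of a] by auto
  then have "(\<Sum>b<k. \<Sum>a<b. (x a - x b)\<^sup>2) = real k * (\<Sum>a<k. x a) - (\<Sum>a<k. x a)\<^sup>2"
    by (simp add: sum_pairs_diff_squared)
  also have "\<dots> = (real k)\<^sup>2 / 4 - (real k / 2 - (\<Sum>a<k. x a))\<^sup>2"
    by (simp add: power2_eq_square algebra_simps)
  also have "\<dots> \<le> (real k)\<^sup>2 / 4"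
    by simp
  finally show ?thesis .
qed

text \<open>A shift by \<open>d\<close> is composed of \<open>d\<close> unit shifts, and each of
  these telescopes in \<open>t\<close> to a difference of two values in [0, 1]. The bound is
  therefore independent of \<open>N\<close>.\<close>

lemma sum_shift_diff_le:
  fixes f :: "nat \<Rightarrow> real"
  assumes "\<And>t. 0 \<le> f t" "\<And>t. f t \<le> 1"
  shows "(\<Sum>t<N. f (t + c) - f (t + (c + d))) \<le> real d"
proof (induction d)
  case (Suc d)
  have "(\<Sum>t<N. f (t + (c + d)) - f (t + (c + Suc d))) = f (c + d) - f (N + (c + d))"
    by (induction N) (simp_all add: algebra_simps)
  also have "\<dots> \<le> 1"
    using assms(1)[of "N + (c + d)"] assms(2)[of "c + d"] by simp
  finally have "(\<Sum>t<N. f (t + (c + d)) - f (t + (c + Suc d))) \<le> 1" .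
  moreover have "(\<Sum>t<N. f (t + c) - f (t + (c + Suc d))) =
      (\<Sum>t<N. f (t + c) - f (t + (c + d))) + (\<Sum>t<N. f (t + (c + d)) - f (t + (c + Suc d)))"
    by (simp flip: sum.distrib)
  ultimately show ?case
    using Suc by simp
qed simp

section \<open>The arcs built from powers of two\<close>

definition sidon_index :: "nat \<Rightarrow> nat \<Rightarrow> (nat \<times> nat \<times> nat) set" where
  "sidon_index N k = {..<N} \<times> (SIGMA b:{..<k}. {..<b})"

definition sidon_arc :: "nat \<times> nat \<times> nat \<Rightarrow> nat \<times> nat" where
  "sidon_arc = (\<lambda>(t, b, a). (t + 2 ^ a, t + 2 ^ b))"

lemma finite_sidon_index: "finite (sidon_index N k)"
  by (simp add: sidon_index_def)

lemma sum_sidon_index: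
  "(\<Sum>p\<in>sidon_index N k. h p) = (\<Sum>t<N. \<Sum>b<k. \<Sum>a<b. h (t, b, a))"
  unfolding sidon_index_def by (simp add: sum.Sigma case_prod_beta)

lemma sum_lessThan_real: "(\<Sum>b<k. real b) = real k * (real k - 1) / 2"
  by (induction k) (simp_all add: field_simps)

lemma card_sidon_index: "real (card (sidon_index N k)) = real N * (real k * (real k - 1) / 2)"
  by (simp add: sidon_index_def card_cartesian_product sum_lessThan_real)

text \<open>If \<open>b < b'\<close>, both terms on the left are at most half of
  \<open>2 ^ b'\<close>, so the left side is smaller than the right. Using this in both directions
  gives \<open>b = b'\<close>.\<close>

lemma power2_diff_unique:
  fixes a b a' b' :: nat
  assumes "a < b" "a' < b'" "(2::nat) ^ b + 2 ^ a' = 2 ^ b' + 2 ^ a"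
  shows "b \<ge> b'"
proof (rule ccontr)
  assume "\<not> b \<ge> b'"
  then have "(2::nat) ^ Suc b \<le> 2 ^ b'" "(2::nat) ^ Suc a' \<le> 2 ^ b'"
    using assms by (auto intro!: power_increasing simp del: power_Suc)
  moreover have "(2::nat) ^ a > 0"
    by simp
  ultimately show False
    using assms(3) by simp
qed

lemma inj_on_sidon_arc: "inj_on sidon_arc (sidon_index N k)"
proof (rule inj_onI)
  fix p q
  assume "p \<in> sidon_index N k" "q \<in> sidon_index N k" "sidon_arc p = sidon_arc q"
  moreover obtain t b a t' b' a' where pq: "p = (t, b, a)" "q = (t', b', a')"
    by (metis prod_cases3)
  ultimately have p: "(t, b, a) \<in> sidon_index N k" "(t', b', a') \<in> sidon_index N k"
    and "sidon_arc (t, b, a) = sidon_arc (t', b', a')"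
    by simp_all
  then have eq: "t + 2 ^ a = t' + 2 ^ a'" "t + 2 ^ b = t' + 2 ^ b'"
    by (simp_all add: sidon_arc_def)
  have ab: "a < b" "a' < b'"
    using p by (simp_all add: sidon_index_def)
  \<comment> \<open>Comparing the two coordinates eliminates \<open>t\<close> and
    \<open>t'\<close>.\<close>
  have "(2::nat) ^ b + 2 ^ a' = 2 ^ b' + 2 ^ a"
    using eq by linarith
  then have b: "b = b'"
    using power2_diff_unique[OF ab] power2_diff_unique[OF ab(2) ab(1)] by simp
  then have "t = t'"
    using eq(2) by simp
  then show "p = q"
    using eq(1) b by (simp add: pq)
qed

section \<open>The cut bound for these arcs\<close>

lemma card_sidon_cut_le:
  assumes S: "S \<subseteq> sidon_arc ` sidon_index N k" and cut: "\<forall>u\<in>S. \<forall>v\<in>S. fst u \<noteq> snd v"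
  shows "real (card S) \<le> real N * (real k)\<^sup>2 / 8 + real k * (real k - 1) / 4 * 2 ^ k"
proof -
  define f :: "nat \<Rightarrow> real" where "f v = of_bool (v \<in> fst ` S)" for v
  have f01: "f v \<in> {0, 1}" for v
    by (simp add: f_def)
  have f_bounds: "0 \<le> f v" "f v \<le> 1" for v
    by (simp_all add: f_def)
  let ?T = "{p \<in> sidon_index N k. sidon_arc p \<in> S}"
  have "S \<subseteq> sidon_arc ` ?T"
    using S by auto
  then have "card S \<le> card ?T"
    by (rule surj_card_le[rotated]) (simp add: finite_sidon_index)
  then have "real (card S) \<le> real (card ?T)"
    by simp
  also have "\<dots> = (\<Sum>p\<in>?T. 1)"
    by simp
  also have "\<dots> = (\<Sum>p\<in>?T. f (fst (sidon_arc p)) * (1 - f (snd (sidon_arc p))))"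
  proof (rule sum.cong[OF refl])
    fix p assume "p \<in> ?T"
    then have "fst (sidon_arc p) \<in> fst ` S" "snd (sidon_arc p) \<notin> fst ` S"
      using cut by fastforce+
    then show "1 = f (fst (sidon_arc p)) * (1 - f (snd (sidon_arc p)))"
      by (simp add: f_def)
  qed
  \<comment> \<open>The added terms are nonnegative because \<open>f\<close> takes values in
    [0, 1].\<close>
  also have "\<dots> \<le> (\<Sum>p\<in>sidon_index N k. f (fst (sidon_arc p)) * (1 - f (snd (sidon_arc p))))"
    by (rule sum_mono2) (auto simp: finite_sidon_index f_bounds)
  also have "\<dots> = (\<Sum>t<N. \<Sum>b<k. \<Sum>a<b. f (t + 2 ^ a) * (1 - f (t + 2 ^ b)))"
    by (simp add: sum_sidon_index sidon_arc_def)
  also have "\<dots> = (\<Sum>t<N. \<Sum>b<k. \<Sum>a<b.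
      (f (t + 2 ^ a) - f (t + 2 ^ b)) / 2 + (f (t + 2 ^ a) - f (t + 2 ^ b))\<^sup>2 / 2)"
  proof (intro sum.cong refl)
    fix t a b :: nat
    \<comment> \<open>These are the antisymmetric and symmetric parts under exchange of
      \<open>x\<close> and \<open>y\<close>, rewritten using that 0 and 1 equal their
      squares.\<close>
    have "x * (1 - y) = (x - y) / 2 + (x - y)\<^sup>2 / 2" if "x \<in> {0, 1}" "y \<in> {0, 1}" for x y :: real
      using that by auto
    from this[OF f01 f01] show "f (t + 2 ^ a) * (1 - f (t + 2 ^ b)) =
        (f (t + 2 ^ a) - f (t + 2 ^ b)) / 2 + (f (t + 2 ^ a) - f (t + 2 ^ b))\<^sup>2 / 2" .
  qed
  also have "\<dots> = (\<Sum>t<N. \<Sum>b<k. \<Sum>a<b. f (t + 2 ^ a) - f (t + 2 ^ b)) / 2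
      + (\<Sum>t<N. \<Sum>b<k. \<Sum>a<b. (f (t + 2 ^ a) - f (t + 2 ^ b))\<^sup>2) / 2"
    by (simp only: sum.distrib sum_divide_distrib)
  \<comment> \<open>The sum over \<open>t\<close> moves inside, so that it telescopes for each fixed
    pair.\<close>
  also have "(\<Sum>t<N. \<Sum>b<k. \<Sum>a<b. f (t + 2 ^ a) - f (t + 2 ^ b))
      = (\<Sum>b<k. \<Sum>a<b. \<Sum>t<N. f (t + 2 ^ a) - f (t + 2 ^ b))"
    by (rule trans[OF sum.swap], rule sum.cong[OF refl], rule sum.swap)
  also have "\<dots> \<le> (\<Sum>b<k. \<Sum>a<b. 2 ^ k)"
  proof (intro sum_mono)
    fix a b assume "b \<in> {..<k}" "a \<in> {..<b}"
    then have "(2::nat) ^ a \<le> 2 ^ b" "(2::nat) ^ b \<le> 2 ^ k"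
      by simp_all
    then have "(\<Sum>t<N. f (t + 2 ^ a) - f (t + 2 ^ b)) \<le> real (2 ^ b - 2 ^ a)"
      using sum_shift_diff_le[where f = f and c = "2 ^ a" and d = "2 ^ b - 2 ^ a", OF f_bounds] by simp
    also have "\<dots> \<le> real (2 ^ k)"
      unfolding of_nat_le_iff using \<open>(2::nat) ^ b \<le> 2 ^ k\<close> by linarith
    finally show "(\<Sum>t<N. f (t + 2 ^ a) - f (t + 2 ^ b)) \<le> 2 ^ k"
      by simp
  qed
  also have "\<dots> = real k * (real k - 1) / 2 * 2 ^ k"
    by (simp add: sum_distrib_right[symmetric] sum_lessThan_real)
  also have "(\<Sum>t<N. \<Sum>b<k. \<Sum>a<b. (f (t + 2 ^ a) - f (t + 2 ^ b))\<^sup>2) \<le> (\<Sum>t<N. (real k)\<^sup>2 / 4)"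
    by (rule sum_mono, rule sum_pairs_diff_squared_le, rule f01)
  finally show ?thesis
    by simp
qed

lemma shift_alpha_le:
  assumes "k \<ge> 2" "N > 0"
  shows "shift_alpha (N + 2 ^ k) \<le> real k / (4 * (real k - 1)) + 2 ^ k / (2 * real N)"
proof -
  let ?G = "sidon_arc ` sidon_index N k" and ?n = "N + 2 ^ k"
  let ?H = "shift_graph ?n \<restriction> ?G"
  have sub: "?G \<subseteq> verts (shift_graph ?n)"
  proof (clarsimp simp: verts_shift_graph sidon_arc_def sidon_index_def)
    fix t b a :: nat
    assume "t < N" "b < k" "a < b"
    \<comment> \<open>The first inequality keeps the heads within \<open>N + 2 ^ k\<close>; the
      second makes the tails positive even for \<open>t = 0\<close>.\<close>
    moreover from this have "(2::nat) ^ b < 2 ^ k" "(2::nat) ^ a > 0"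
      by simp_all
    ultimately show "Suc 0 \<le> t + 2 ^ a \<and> t + 2 ^ b \<le> N + 2 ^ k"
      by linarith
  qed
  have card: "real (card ?G) = real N * (real k * (real k - 1) / 2)"
    by (simp add: card_image[OF inj_on_sidon_arc] card_sidon_index)
  have pos: "real (card ?G) > 0"
    unfolding card using assms by simp
  then have "?G \<noteq> {}"
    by force
  from shift_alpha_attained(2)[OF this sub]
  have "shift_alpha ?n \<le> real (independence_number ?H) / real (card ?G)" .
  also have "real (independence_number ?H)
      \<le> real N * (real k)\<^sup>2 / 8 + real k * (real k - 1) / 4 * 2 ^ k"
  proof -
    have "finite (verts ?H)"
      by (simp add: finite_sidon_index)
    then obtain S where S: "independent_set ?H S" "card S = independence_number ?H"
      using independence_number_attained(1) by blast
    show ?thesis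
      using card_sidon_cut_le[of S N k] S(1) unfolding independent_set_induced_iff[OF sub] S(2)
      by blast
  qed
  also have "(real N * (real k)\<^sup>2 / 8 + real k * (real k - 1) / 4 * 2 ^ k) / real (card ?G)
      = real k / (4 * (real k - 1)) + 2 ^ k / (2 * real N)"
    using assms unfolding card by (simp add: divide_simps power2_eq_square) (simp add: algebra_simps)
  finally show ?thesis
    using pos by (simp add: divide_right_mono)
qed

theorem theorem1p2:
  shows "shift_alpha \<longlonglongrightarrow> 1 / 4"
proof (rule order_tendstoI)
  fix c :: real
  assume "c < 1 / 4"
  \<comment> \<open>The bound starts at 2, where the minimum is first taken over a nonempty
    set.\<close>
  then show "\<forall>\<^sub>F n in sequentially. c < shift_alpha n"
    using shift_alpha_ge by (intro eventually_sequentiallyI[of 2]) fastforce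
next
  fix c :: real
  assume "1 / 4 < c"
  have "(\<lambda>m. 1 / 4 + 1 / 4 * inverse (real (Suc m))) \<longlonglongrightarrow> 1 / 4 + 1 / 4 * 0"
    by (intro tendsto_intros LIMSEQ_inverse_real_of_nat)
  then have "\<forall>\<^sub>F m in sequentially. 1 / 4 + 1 / 4 * inverse (real (Suc m)) < c"
    using \<open>1 / 4 < c\<close> by (intro order_tendstoD(2)) auto
  then obtain m where m: "1 / 4 + 1 / 4 * inverse (real (Suc m)) < c"
    by (auto simp: eventually_sequentially)
  \<comment> \<open>Then \<open>Suc m\<close> is \<open>k - 1\<close>, and
    \<open>k / (4 * (k - 1))\<close> equals \<open>1 / 4 + 1 / (4 * (k - 1))\<close>. This
    \<open>k\<close> stays fixed while \<open>N\<close> grows and the other error term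
    vanishes.\<close>
  define k where "k = m + 2"
  have "k \<ge> 2" and k: "real k / (4 * (real k - 1)) < c"
    using m by (simp_all add: k_def field_simps)
  have "(\<lambda>N. real k / (4 * (real k - 1)) + 2 ^ k / 2 * inverse (real N))
      \<longlonglongrightarrow> real k / (4 * (real k - 1)) + 2 ^ k / 2 * 0"
    by (intro tendsto_intros lim_inverse_n)
  then have "\<forall>\<^sub>F N in sequentially.
      real k / (4 * (real k - 1)) + 2 ^ k / 2 * inverse (real N) < c"
    using k by (intro order_tendstoD(2)) auto
  then have "\<forall>\<^sub>F N in sequentially. shift_alpha (N + 2 ^ k) < c"
    using eventually_gt_at_top[of "0::nat"]
  proof eventually_elim
    case (elim N)
    have "2 ^ k / (2 * real N) = 2 ^ k / 2 * inverse (real N)"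
      by (simp add: field_simps)
    then show ?case
      using shift_alpha_le[OF \<open>k \<ge> 2\<close> elim(2)] elim(1) by linarith
  qed
  \<comment> \<open>With \<open>k\<close> fixed, \<open>N + 2 ^ k\<close> runs through all large
    indices.\<close>
  then show "\<forall>\<^sub>F n in sequentially. shift_alpha n < c"
    by (rule iffD1[OF eventually_sequentially_seg])
qed

end
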